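(* Consider a deterministic Markov decision process (MDP) with a safety objective, with finite state space $S$, state $s^*\in S$ to be avoided, finite nonempty action sets $A(s)$ and transition probabilities $p(\cdot\mid s,a)$; that is, for each state $s\neq s^*$ and every action $a\in A(s)$ there is a state $z\in S$ such that $p(\{z,s^*\}\mid s,a)=1$. Then there exists a pure stationary strategy $\sigma$ such that, for every initial state $s\in S\setminus\{s^*\}$, no other pure strategy weakly overtakes $\sigma$ (in the sense of the safety objective) at the initial state $s$.
   Context: An MDP with a safety objective is given by a finite set $S$ of states with a distinguished state $s^*\in S$ that the decision maker wants to avoid, for each $s\in S$ a nonempty finite set $A(s)$ of actions, and for each $s\in S$, $a\in A(s)$ a probability distribution $p(\cdot\mid s,a)$ on $S$. Play runs over periods $1,2,3,\ldots$: it starts at period 1 in an initial state $s_1\in S\setminus\{s^*\}$; at each period $t$ the decision maker chooses an action $a_t\in A(s_t)$ and $s_{t+1}$ is drawn from $p(\cdot\mid s_t,a_t)$. A history at period $t$ is a sequence $(s_1,a_1,\ldots,s_{t-1},a_{t-1},s_t)$ with $a_i\in A(s_i)$ and $p(s_{i+1}\mid s_i,a_i)>0$ for all $i<t$; its final state is $s_t$. A strategy $\sigma$ assigns to each history $h$ a probability distribution $\sigma(h)$ on $A(s)$, where $s$ is the final state of $h$. It is pure if every $\sigma(h)$ puts probability 1 on one action, and stationary if $\sigma(h)$ depends only on the final state of $h$. $\mathbb{P}_{s\sigma}$ denotes the probability measure on infinite histories induced by initial state $s$ and strategy $\sigma$. Let $t^*$ be the first period at which the state is $s^*$ ($t^*=\infty$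 if $s^*$ is never reached). For the safety objective, a strategy $\sigma'$ weakly overtakes a strategy $\sigma$ at the initial state $s$ if there is $T\in\mathbb{N}$ such that $\mathbb{P}_{s\sigma'}(t^*\leq t)\leq\mathbb{P}_{s\sigma}(t^*\leq t)$ for all $t\geq T$, with strict inequality for infinitely many $t$. *)

theory Defs
  imports "HOL-Probability.Probability"
begin

record ('s, 'a) safety_mdp =
  states :: "'s set"
  avoid :: 's
  actions :: "'s \<Rightarrow> 'a set"
  tprob :: "'s \<Rightarrow> 'a \<Rightarrow> 's pmf"

definition is_safety_mdp :: "('s, 'a) safety_mdp \<Rightarrow> bool" where
  "is_safety_mdp M \<longleftrightarrow>
     finite (states M) \<and> avoid M \<in> states M \<and>
     (\<forall>s\<in>states M. finite (actions M s) \<and> actions M s \<noteq> {}) \<and>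
     (\<forall>s\<in>states M. \<forall>a\<in>actions M s. set_pmf (tprob M s a) \<subseteq> states M)"

definition deterministic :: "('s, 'a) safety_mdp \<Rightarrow> bool" where
  "deterministic M \<longleftrightarrow>
     (\<forall>s\<in>states M - {avoid M}. \<forall>a\<in>actions M s.
        \<exists>z\<in>states M. measure_pmf.prob (tprob M s a) {z, avoid M} = 1)"

(* The sequence (s_1, a_1, ..., s_{t-1}, a_{t-1}, s_t) is encoded as
   ([(s_1, a_1), ..., (s_{t-1}, a_{t-1})], s_t). *)
type_synonym ('s, 'a) hist = "('s \<times> 'a) list \<times> 's"

definition history :: "('s, 'a) safety_mdp \<Rightarrow> ('s, 'a) hist \<Rightarrow> bool" where
  "history M h \<longleftrightarrow> (case h of (xs, s) \<Rightarrow>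
     s \<in> states M \<and>
     (\<forall>(z, a)\<in>set xs. z \<in> states M \<and> a \<in> actions M z) \<and>
     (\<forall>i<length xs. pmf (tprob M (fst (xs ! i)) (snd (xs ! i)))
                        ((map fst xs @ [s]) ! Suc i) > 0))"

(* Strategies are total functions; their values outside the histories are irrelevant. *)
type_synonym ('s, 'a) strat = "('s, 'a) hist \<Rightarrow> 'a pmf"

definition strategy :: "('s, 'a) safety_mdp \<Rightarrow> ('s, 'a) strat \<Rightarrow> bool" where
  "strategy M \<sigma> \<longleftrightarrow> (\<forall>h. history M h \<longrightarrow> set_pmf (\<sigma> h) \<subseteq> actions M (snd h))"

definition pure :: "('s, 'a) safety_mdp \<Rightarrow> ('s, 'a) strat \<Rightarrow> bool" where
  "pure M \<sigma> \<longleftrightarrow> (\<forall>h. history M h \<longrightarrow> (\<exists>a. pmf (\<sigma> h) a = 1))"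

definition stationary :: "('s, 'a) safety_mdp \<Rightarrow> ('s, 'a) strat \<Rightarrow> bool" where
  "stationary M \<sigma> \<longleftrightarrow>
     (\<forall>h h'. history M h \<and> history M h' \<and> snd h = snd h' \<longrightarrow> \<sigma> h = \<sigma> h')"

(* An infinite history is a function \<omega> with \<omega> n = (s_{n+1}, a_{n+1}): coordinate n is period n + 1. *)
abbreviation play_space :: "nat \<Rightarrow> ('s \<times> 'a) measure" where
  "play_space \<equiv> \<lambda>_. count_space UNIV"

definition next_state :: "('s, 'a) safety_mdp \<Rightarrow> 's \<Rightarrow> ('s \<times> 'a) list \<Rightarrow> 's pmf" where
  "next_state M s xs =
     (if xs = [] then return_pmf s else tprob M (fst (last xs)) (snd (last xs)))"

(* Conditional law of (s_{n+1}, a_{n+1}) given the first n state-action pairs. The value on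
   sequences that extend to no history is arbitrary (they have probability 0); fixing it to a
   constant makes the kernel measurable although the types 's and 'a may be uncountable. *)
definition play_kernel ::
  "('s, 'a) safety_mdp \<Rightarrow> 's \<Rightarrow> ('s, 'a) strat \<Rightarrow> nat \<Rightarrow> (nat \<Rightarrow> 's \<times> 'a) \<Rightarrow> ('s \<times> 'a) measure"
where
  "play_kernel M s \<sigma> n \<omega> = (let xs = map \<omega> [0..<n] in
     if \<exists>z. history M (xs, z)
     then measure_pmf (bind_pmf (next_state M s xs)
            (\<lambda>z. map_pmf (\<lambda>a. (z, a)) (\<sigma> (xs, z))))
     else measure_pmf (return_pmf undefined))"

(* The Ionescu-Tulcea measure of these kernels, on the product sigma-algebra. *)
definition play_measure ::
  "('s, 'a) safety_mdp \<Rightarrow> 's \<Rightarrow> ('s, 'a) strat \<Rightarrow> (nat \<Rightarrow> 's \<times> 'a) measure" where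
  "play_measure M s \<sigma> =
     projective_family.lim UNIV (Ionescu_Tulcea.CI (play_kernel M s \<sigma>) play_space) play_space"

definition hit_time :: "('s, 'a) safety_mdp \<Rightarrow> (nat \<Rightarrow> 's \<times> 'a) \<Rightarrow> enat" where
  "hit_time M \<omega> = (INF n\<in>{n. fst (\<omega> n) = avoid M}. enat (Suc n))"

definition hit_prob :: "('s, 'a) safety_mdp \<Rightarrow> 's \<Rightarrow> ('s, 'a) strat \<Rightarrow> nat \<Rightarrow> real" where
  "hit_prob M s \<sigma> t =
     measure (play_measure M s \<sigma>) {\<omega> \<in> space (play_measure M s \<sigma>). hit_time M \<omega> \<le> enat t}"

definition weakly_overtakes ::
  "('s, 'a) safety_mdp \<Rightarrow> 's \<Rightarrow> ('s, 'a) strat \<Rightarrow> ('s, 'a) strat \<Rightarrow> bool" where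
  "weakly_overtakes M s \<sigma>' \<sigma> \<longleftrightarrow>
     (\<exists>T. \<forall>t\<ge>T. hit_prob M s \<sigma>' t \<le> hit_prob M s \<sigma> t) \<and>
     infinite {t. hit_prob M s \<sigma>' t < hit_prob M s \<sigma> t}"

lemma hit_time_le_iff: "hit_time M \<omega> \<le> enat t \<longleftrightarrow> (\<exists>n<t. fst (\<omega> n) = avoid M)"
proof
  assume le: "hit_time M \<omega> \<le> enat t"
  show "\<exists>n<t. fst (\<omega> n) = avoid M"
  proof (rule ccontr)
    assume neg: "\<not> (\<exists>n<t. fst (\<omega> n) = avoid M)"
    have "enat (Suc t) \<le> hit_time M \<omega>"
      unfolding hit_time_def
    proof (rule INF_greatest)
      fix n assume "n \<in> {n. fst (\<omega> n) = avoid M}"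
      with neg have "\<not> n < t" by blast
      then show "enat (Suc t) \<le> enat (Suc n)" by simp
    qed
    from order_trans[OF this le] show False by simp
  qed
next
  assume "\<exists>n<t. fst (\<omega> n) = avoid M"
  then obtain n where n: "n < t" "fst (\<omega> n) = avoid M" by blast
  have "hit_time M \<omega> \<le> enat (Suc n)"
    unfolding hit_time_def by (rule INF_lower) (simp add: n)
  moreover have "enat (Suc n) \<le> enat t" using n by simp
  ultimately show "hit_time M \<omega> \<le> enat t" by (rule order_trans)
qed

lemma hit_event_measurable:
  "{\<omega> \<in> space (PiM UNIV play_space). hit_time M \<omega> \<le> enat t} \<in> sets (PiM UNIV play_space)"
proof -
  have "(\<lambda>\<omega>. \<omega> n) -` {x. fst x = avoid M} \<inter> space (PiM UNIV play_space) \<in> sets (PiM UNIV play_space)"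
    for n :: nat
    by (rule measurable_sets[OF measurable_component_singleton]) simp_all
  then have "(\<Union>n<t. (\<lambda>\<omega>. \<omega> n) -` {x. fst x = avoid M} \<inter> space (PiM UNIV play_space))
      \<in> sets (PiM UNIV play_space)"
    by (intro sets.finite_UN) simp_all
  moreover have "{\<omega> \<in> space (PiM UNIV play_space). hit_time M \<omega> \<le> enat t} =
      (\<Union>n<t. (\<lambda>\<omega>. \<omega> n) -` {x. fst x = avoid M} \<inter> space (PiM UNIV play_space))"
    unfolding hit_time_le_iff by blast
  ultimately show ?thesis by simp
qed

lemma finite_history_prefixes:
  assumes "is_safety_mdp M"
  shows "finite {xs. length xs = n \<and> (\<exists>z. history M (xs, z))}"
proof (rule finite_subset)
  show "{xs. length xs = n \<and> (\<exists>z. history M (xs, z))}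
     \<subseteq> {xs. set xs \<subseteq> (SIGMA s:states M. actions M s) \<and> length xs = n}"
    by (force simp: history_def)
  show "finite {xs. set xs \<subseteq> (SIGMA s:states M. actions M s) \<and> length xs = n}"
    using assms by (intro finite_lists_length_eq finite_SigmaI) (auto simp: is_safety_mdp_def)
qed

lemma play_kernel_prob_space: "prob_space (play_kernel M s \<sigma> n \<omega>)"
  by (simp add: play_kernel_def Let_def measure_pmf.prob_space_axioms)

lemma measurable_play_kernel:
  fixes M :: "('s, 'a) safety_mdp"
  assumes "is_safety_mdp M"
  shows "play_kernel M s \<sigma> n \<in> measurable (PiM {0..<n} play_space) (subprob_algebra (count_space UNIV))"
proof -
  define X where "X = {xs. length xs = n \<and> (\<exists>z. history M (xs, z))}"
  have fin: "finite X" unfolding X_def by (rule finite_history_prefixes[OF assms])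
  define g where "g \<omega> = (let xs = map \<omega> [0..<n] in if xs \<in> X then Some xs else None)"
    for \<omega> :: "nat \<Rightarrow> 's \<times> 'a"
  define K where "K y = (case y of None \<Rightarrow> measure_pmf (return_pmf undefined)
     | Some xs \<Rightarrow> measure_pmf (bind_pmf (next_state M s xs)
            (\<lambda>z. map_pmf (\<lambda>a. (z, a)) (\<sigma> (xs, z)))))" for y
  have eq: "play_kernel M s \<sigma> n = (\<lambda>\<omega>. K (g \<omega>))"
    by (auto simp: fun_eq_iff play_kernel_def K_def g_def X_def Let_def)
  have sing: "g -` {Some xs} \<inter> space (PiM {0..<n} play_space) \<in> sets (PiM {0..<n} play_space)"
    if "xs \<in> X" for xs
  proof -
    have "g -` {Some xs} \<inter> space (PiM {0..<n} play_space) = PiE {0..<n} (\<lambda>i. {xs ! i})"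
    proof -
      have "map \<omega> [0..<n] = xs \<longleftrightarrow> (\<forall>i<n. \<omega> i = xs ! i)" for \<omega>
        using that by (auto simp: X_def list_eq_iff_nth_eq)
      then have "g \<omega> = Some xs \<longleftrightarrow> (\<forall>i<n. \<omega> i = xs ! i)" for \<omega>
        using that unfolding g_def Let_def by (metis option.distinct(1) option.inject)
      then show ?thesis
        by (simp add: set_eq_iff space_PiM PiE_iff Ball_def)
    qed
    then show ?thesis by (simp only:) (rule sets_PiM_I_finite, simp_all)
  qed
  have "g \<in> measurable (PiM {0..<n} play_space) (count_space (insert None (Some ` X)))"
  proof (subst measurable_count_space_eq2)
    show "finite (insert None (Some ` X))" using fin by simp
    have "g -` {None} \<inter> space (PiM {0..<n} play_space) =
        space (PiM {0..<n} play_space) - (\<Union>xs\<in>X. g -` {Some xs} \<inter> space (PiM {0..<n} play_space))"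
      unfolding g_def Let_def by (auto split: if_splits)
    also have "\<dots> \<in> sets (PiM {0..<n} play_space)"
      using fin sing by (intro sets.Diff sets.top sets.finite_UN) auto
    finally have "g -` {None} \<inter> space (PiM {0..<n} play_space) \<in> sets (PiM {0..<n} play_space)" .
    moreover have "g \<in> space (PiM {0..<n} play_space) \<rightarrow> insert None (Some ` X)"
      by (simp add: g_def Let_def)
    ultimately show "g \<in> space (PiM {0..<n} play_space) \<rightarrow> insert None (Some ` X) \<and>
       (\<forall>a\<in>insert None (Some ` X).
          g -` {a} \<inter> space (PiM {0..<n} play_space) \<in> sets (PiM {0..<n} play_space))"
      using sing by blast
  qed
  moreover have "K \<in> measurable (count_space (insert None (Some ` X))) (subprob_algebra (count_space UNIV))"
    unfolding measurable_count_space_eq1 K_def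
    by (simp add: space_subprob_algebra measure_pmf.subprob_space_axioms Pi_iff split: option.split)
  ultimately show ?thesis
    unfolding eq by (rule measurable_compose)
qed

lemma Ionescu_Tulcea_play_kernel:
  assumes "is_safety_mdp M"
  shows "Ionescu_Tulcea (play_kernel M s \<sigma>) play_space"
  by (rule Ionescu_Tulcea.intro) (rule measurable_play_kernel[OF assms] play_kernel_prob_space)+

end

theory Submission
  imports Defs
begin

text \<open>
  Under a pure strategy, as long as the avoided state is not reached, the play follows a single path,
  and the probability of surviving is the product of the survival probabilities along it. With
  costs \<open>- ln\<close> of these, a strategy overtakes another one iff its path is eventually no more
  expensive and infinitely often cheaper. States from which every path hits an edge of survival
  probability 0 are harmless; on the others we have a finite graph with real costs.

  On a finite cost graph there is a stationary choice \<open>f\<close> that minimises the \<open>\<beta>\<close>-discounted cost for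
  infinitely many terms of a sequence of discount factors tending to 1. Let \<open>D t\<close> be the cost up to
  time \<open>t\<close> of the orbit of \<open>f\<close> minus that of another walk. If \<open>D\<close> is eventually nonnegative, then
  discounted optimality gives an upper bound on \<open>\<Sum>D t\<close>, so \<open>D\<close> tends to 0. Suppose \<open>D t > 0\<close> for infinitely
  many \<open>t\<close>. By pigeonhole there are two such times \<open>t1 < t2\<close> at which both paths are in the
  same pair of states and \<open>D t2 < D t1\<close>. Cutting the loop of the walk between \<open>t1\<close> and \<open>t2\<close>
  yields a walk whose \<open>D\<close> is eventually at least \<open>D t1 - D t2\<close>, a contradiction.
\<close>

subsection \<open>Vanishing discount on finite cost graphs\<close>

text \<open>The discounted series of the partial sums is the Cauchy product of the discounted series
  of \<open>d\<close> with the geometric series, hence nonpositive. Its terms from index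
  \<open>N\<close> on are nonnegative, so truncating at \<open>N\<close> can only lower the
  value.\<close>

lemma Abel_partial_sums_nonpos:
  fixes d :: "nat \<Rightarrow> real"
  assumes bound: "\<And>k. \<bar>d k\<bar> \<le> C" and \<beta>: "0 < \<beta>" "\<beta> < 1"
    and disc: "(\<Sum>k. \<beta> ^ k * d k) \<le> 0"
    and nonneg: "\<And>t. t \<ge> T \<Longrightarrow> 0 \<le> (\<Sum>i<t. d i)" and "T \<le> N"
  shows "(\<Sum>k<N. \<beta> ^ k * (\<Sum>i<Suc k. d i)) \<le> 0"
proof -
  have sb: "summable (\<lambda>k. norm (\<beta> ^ k))"
    using \<beta> by (auto intro: summable_geometric)
  have sd: "summable (\<lambda>k. norm (\<beta> ^ k * d k))"
  proof (rule summable_comparison_test')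
    show "summable (\<lambda>k. \<beta> ^ k * C)"
      using \<beta> by (intro summable_mult2 summable_geometric) auto
    show "norm (norm (\<beta> ^ k * d k)) \<le> \<beta> ^ k * C" if "k \<ge> 0" for k
      using bound[of k] \<beta> by (simp add: abs_mult mult_left_mono)
  qed
  have eq: "(\<Sum>i\<le>k. (\<beta> ^ i * d i) * \<beta> ^ (k - i)) = \<beta> ^ k * (\<Sum>i<Suc k. d i)" for k
  proof -
    have "(\<Sum>i\<le>k. (\<beta> ^ i * d i) * \<beta> ^ (k - i)) = (\<Sum>i\<le>k. \<beta> ^ k * d i)"
    proof (rule sum.cong)
      fix i assume "i \<in> {..k}"
      then have "\<beta> ^ k = \<beta> ^ i * \<beta> ^ (k - i)"
        by (simp add: power_add[symmetric])
      then show "(\<beta> ^ i * d i) * \<beta> ^ (k - i) = \<beta> ^ k * d i" by simp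
    qed simp
    then show ?thesis by (simp add: sum_distrib_left lessThan_Suc_atMost)
  qed
  have sums: "(\<lambda>k. \<beta> ^ k * (\<Sum>i<Suc k. d i)) sums ((\<Sum>k. \<beta> ^ k * d k) * (\<Sum>k. \<beta> ^ k))"
    using Cauchy_product_sums[OF sd sb] unfolding eq .
  have "(\<Sum>k<N. \<beta> ^ k * (\<Sum>i<Suc k. d i)) \<le> (\<Sum>k. \<beta> ^ k * (\<Sum>i<Suc k. d i))"
  proof (rule sum_le_suminf)
    show "0 \<le> \<beta> ^ n * sum d {..<Suc n}" if "n \<in> - {..<N}" for n
      using that \<open>T \<le> N\<close> \<beta> by (intro mult_nonneg_nonneg nonneg) auto
  qed (use sums in \<open>auto dest: sums_summable\<close>)
  also have "\<dots> = (\<Sum>k. \<beta> ^ k * d k) * (\<Sum>k. \<beta> ^ k)"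
    using sums by (rule sums_unique[symmetric])
  also have "\<dots> \<le> 0"
    using disc \<beta> sb by (intro mult_nonpos_nonneg suminf_nonneg) auto
  finally show ?thesis .
qed

text \<open>For fixed \<open>N \<ge> T\<close>, the truncated bound of
  \<open>Abel_partial_sums_nonpos\<close> holds for infinitely many \<open>n\<close>, and a finite
  sum is continuous in the discount factor, so the undiscounted sum is nonpositive too. A series
  with eventually nonnegative terms and bounded partial sums converges, so its terms tend to
  0.\<close>

lemma vanishing_discount_partial_sums:
  fixes d :: "nat \<Rightarrow> real" and \<beta> :: "nat \<Rightarrow> real"
  assumes bound: "\<And>k. \<bar>d k\<bar> \<le> C"
    and \<beta>: "\<And>n. 0 < \<beta> n" "\<And>n. \<beta> n < 1" "\<beta> \<longlonglongrightarrow> 1"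
    and disc: "infinite {n. (\<Sum>k. \<beta> n ^ k * d k) \<le> 0}"
    and nonneg: "\<And>t. t \<ge> T \<Longrightarrow> 0 \<le> (\<Sum>i<t. d i)"
  shows "(\<lambda>t. \<Sum>i<t. d i) \<longlonglongrightarrow> 0"
proof -
  define D where "D t = (\<Sum>i<t. d i)" for t
  have sum_D: "(\<Sum>k<N. D (Suc k)) \<le> 0" if "T \<le> N" for N
  proof (rule ccontr)
    assume "\<not> ?thesis"
    moreover have "(\<lambda>n. \<Sum>k<N. \<beta> n ^ k * D (Suc k)) \<longlonglongrightarrow> (\<Sum>k<N. 1 ^ k * D (Suc k))"
      by (intro tendsto_intros \<beta>(3))
    ultimately have "\<forall>\<^sub>F n in sequentially. (\<Sum>k<N. \<beta> n ^ k * D (Suc k)) > 0"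
      by (intro order_tendstoD(1)[where y = "\<Sum>k<N. 1 ^ k * D (Suc k)"]) simp_all
    then obtain n0 where n0: "\<And>n. n \<ge> n0 \<Longrightarrow> (\<Sum>k<N. \<beta> n ^ k * D (Suc k)) > 0"
      by (auto simp: eventually_sequentially)
    obtain n where "n \<ge> n0" "(\<Sum>k. \<beta> n ^ k * d k) \<le> 0"
      using disc by (auto simp: infinite_nat_iff_unbounded_le)
    with n0[of n] Abel_partial_sums_nonpos[OF bound \<beta>(1,2) _ nonneg \<open>T \<le> N\<close>, of n] show False
      by (simp add: D_def)
  qed
  have "summable (\<lambda>k. D (Suc (k + T)))"
  proof (rule summableI_nonneg_bounded)
    show "0 \<le> D (Suc (k + T))" for k unfolding D_def by (rule nonneg) simp
    \<comment> \<open>The first \<open>T\<close> terms have unknown sign; their sum is moved to the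
      right-hand side.\<close>
    show "(\<Sum>k<n. D (Suc (k + T))) \<le> - (\<Sum>k<T. D (Suc k))" for n
    proof -
      have "(\<Sum>k<n + T. D (Suc k)) = (\<Sum>k<T. D (Suc k)) + (\<Sum>k<n. D (Suc (k + T)))"
        by (induction n) auto
      with sum_D[of "n + T"] show ?thesis by simp
    qed
  qed
  then have "(\<lambda>k. D (k + Suc T)) \<longlonglongrightarrow> 0"
    using summable_LIMSEQ_zero by fastforce
  then show ?thesis
    unfolding D_def by (rule LIMSEQ_offset)
qed

section \<open>Discount-optimal stationary choices\<close>

locale cost_graph =
  fixes V :: "'s set" and A :: "'s \<Rightarrow> 'a set" and nx :: "'s \<Rightarrow> 'a \<Rightarrow> 's" and c :: "'s \<Rightarrow> 'a \<Rightarrow> real"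
  assumes finite_V: "finite V"
    and finite_A: "s \<in> V \<Longrightarrow> finite (A s)"
    and A_ne: "s \<in> V \<Longrightarrow> A s \<noteq> {}"
    and nx_in: "s \<in> V \<Longrightarrow> a \<in> A s \<Longrightarrow> nx s a \<in> V"
begin

text \<open>Entries are state-action pairs, as in plays: actions of different cost may lead to the
  same state.\<close>

definition walk :: "'s \<Rightarrow> (nat \<Rightarrow> 's \<times> 'a) \<Rightarrow> bool" where
  "walk s q \<longleftrightarrow> s \<in> V \<and> fst (q 0) = s \<and>
     (\<forall>t. snd (q t) \<in> A (fst (q t)) \<and> fst (q (Suc t)) = nx (fst (q t)) (snd (q t)))"

definition cost :: "(nat \<Rightarrow> 's \<times> 'a) \<Rightarrow> nat \<Rightarrow> real" where
  "cost q t = (\<Sum>i<t. case_prod c (q i))"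

definition discounted :: "real \<Rightarrow> (nat \<Rightarrow> 's \<times> 'a) \<Rightarrow> real" where
  "discounted \<beta> q = (\<Sum>t. \<beta> ^ t * case_prod c (q t))"

definition orbit :: "('s \<Rightarrow> 'a) \<Rightarrow> 's \<Rightarrow> nat \<Rightarrow> 's \<times> 'a" where
  "orbit f s t = (let z = ((\<lambda>x. nx x (f x)) ^^ t) s in (z, f z))"

lemma walk_in: "walk s q \<Longrightarrow> fst (q t) \<in> V"
  by (induction t) (auto simp: walk_def nx_in)

lemma walk_act: "walk s q \<Longrightarrow> snd (q t) \<in> A (fst (q t))"
  by (simp add: walk_def)

lemma walk_shift: "walk s q \<Longrightarrow> walk (fst (q k)) (\<lambda>t. q (t + k))"
  using walk_in by (auto simp: walk_def)

lemma walk_orbit: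
  assumes "f \<in> Pi V A" "s \<in> V"
  shows "walk s (orbit f s)"
proof -
  have "fst (orbit f s t) \<in> V" for t
    using assms by (induction t) (auto simp: orbit_def Let_def intro!: nx_in)
  then show ?thesis
    using assms by (auto simp: walk_def orbit_def Let_def)
qed

lemma orbit_add: "orbit f s (t + k) = orbit f (fst (orbit f s k)) t"
  by (simp add: orbit_def Let_def funpow_add)

lemma c_bounded: "\<exists>C\<ge>0. \<forall>s q t. walk s q \<longrightarrow> \<bar>case_prod c (q t)\<bar> \<le> C"
proof -
  let ?E = "SIGMA s:V. A s"
  have fin: "finite ?E" using finite_V finite_A by auto
  have "\<bar>case_prod c (q t)\<bar> \<le> (\<Sum>e\<in>?E. \<bar>case_prod c e\<bar>)" if "walk s q" for s q t
    using fin walk_in[OF that, of t] walk_act[OF that, of t]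
    by (intro member_le_sum) (simp_all add: mem_Times_iff Sigma_def, metis prod.collapse)
  then show ?thesis
    by (intro exI[of _ "\<Sum>e\<in>?E. \<bar>case_prod c e\<bar>"]) (auto intro: sum_nonneg)
qed

lemma summable_discounted:
  assumes "walk s q" "0 < \<beta>" "\<beta> < 1"
  shows "summable (\<lambda>t. \<beta> ^ t * case_prod c (q t))"
proof -
  obtain C where C: "\<And>t. \<bar>case_prod c (q t)\<bar> \<le> C" using c_bounded assms(1) by blast
  show ?thesis
  proof (rule summable_comparison_test')
    show "summable (\<lambda>k. \<beta> ^ k * C)"
      using assms by (intro summable_mult2 summable_geometric) auto
    show "norm (\<beta> ^ k * case_prod c (q k)) \<le> \<beta> ^ k * C" if "k \<ge> 0" for k
      using C[of k] assms by (simp add: abs_mult mult_left_mono)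
  qed
qed

lemma discounted_split:
  assumes "walk s q" "0 < \<beta>" "\<beta> < 1"
  shows "discounted \<beta> q = case_prod c (q 0) + \<beta> * discounted \<beta> (\<lambda>t. q (Suc t))"
proof -
  have "discounted \<beta> q = (\<Sum>t. \<beta> ^ Suc t * case_prod c (q (Suc t))) + case_prod c (q 0)"
    using suminf_split_head[OF summable_discounted[OF assms]] by (simp add: discounted_def)
  also have "(\<Sum>t. \<beta> ^ Suc t * case_prod c (q (Suc t))) = \<beta> * discounted \<beta> (\<lambda>t. q (Suc t))"
    using summable_discounted[OF walk_shift[OF assms(1), of 1] assms(2,3)]
    by (simp add: discounted_def suminf_mult[symmetric] mult.assoc)
  finally show ?thesis by simp
qed

lemma discounted_bounded:
  assumes "0 < \<beta>" "\<beta> < 1"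
  shows "\<exists>B. \<forall>s q. walk s q \<longrightarrow> \<bar>discounted \<beta> q\<bar> \<le> B"
proof -
  obtain C where C: "\<And>s q t. walk s q \<Longrightarrow> \<bar>case_prod c (q t)\<bar> \<le> C" using c_bounded by blast
  have "\<bar>discounted \<beta> q\<bar> \<le> (\<Sum>t. \<beta> ^ t * C)" if "walk s q" for s q
  proof -
    have sb: "summable (\<lambda>t. \<beta> ^ t * C)"
      using assms by (intro summable_mult2 summable_geometric) auto
    have le: "norm (\<beta> ^ t * case_prod c (q t)) \<le> \<beta> ^ t * C" for t
      using C[OF that, of t] assms by (simp add: abs_mult mult_left_mono)
    show ?thesis
      using norm_suminf_le[OF le sb] by (simp add: discounted_def)
  qed
  then show ?thesis by blast
qed

text \<open>Bellman's argument: with \<open>v\<close> the infimum of the discounted cost over all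
  walks, a choice that minimises the immediate cost plus the discounted \<open>v\<close> of the
  successor attains \<open>v\<close> from every state.\<close>

lemma ex_discount_optimal:
  assumes \<beta>: "0 < \<beta>" "\<beta> < 1"
  shows "\<exists>f\<in>PiE V A. \<forall>s q. walk s q \<longrightarrow> discounted \<beta> (orbit f s) \<le> discounted \<beta> q"
proof -
  obtain B where B: "\<And>s q. walk s q \<Longrightarrow> \<bar>discounted \<beta> q\<bar> \<le> B"
    using discounted_bounded[OF \<beta>] by blast
  define v where "v s = Inf (discounted \<beta> ` {q. walk s q})" for s
  have bdd: "bdd_below (discounted \<beta> ` {q. walk s q})" for s
    using B by (intro bdd_belowI[of _ "-B"]) (fastforce simp: abs_le_iff)
  have v_le: "v s \<le> discounted \<beta> q" if "walk s q" for s q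
    unfolding v_def using that bdd by (intro cInf_lower) auto
  have ex_walk: "\<exists>q. walk s q" if "s \<in> V" for s
  proof -
    have "(\<lambda>s. SOME a. a \<in> A s) \<in> Pi V A" using A_ne by (simp add: some_in_eq)
    from walk_orbit[OF this that] show ?thesis by blast
  qed
  have v_ge: "x \<le> v s" if "s \<in> V" "\<And>q. walk s q \<Longrightarrow> x \<le> discounted \<beta> q" for s x
    unfolding v_def using that ex_walk by (intro cInf_greatest) auto
  have v_bound: "\<bar>v s\<bar> \<le> B" if "s \<in> V" for s
  proof -
    obtain q where "walk s q" using ex_walk \<open>s \<in> V\<close> by blast
    then have "v s \<le> B" using v_le B by (meson abs_le_D1 order_trans)
    moreover have "-B \<le> v s" using B by (intro v_ge that) (fastforce simp: abs_le_iff)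
    ultimately show ?thesis by simp
  qed
  define Q where "Q s a = c s a + \<beta> * v (nx s a)" for s a
  have "\<exists>a\<in>A s. \<forall>b\<in>A s. Q s a \<le> Q s b" if "s \<in> V" for s
    using ex_min_if_finite[of "Q s ` A s"] finite_A A_ne that by (auto simp: not_less)
  then obtain f0 where f0: "\<And>s. s \<in> V \<Longrightarrow> f0 s \<in> A s \<and> (\<forall>b\<in>A s. Q s (f0 s) \<le> Q s b)"
    by metis
  \<comment> \<open>Extensionality puts \<open>f\<close> into the finite set \<open>PiE V A\<close>,
    on which \<open>ex_discount_optimal_sequence\<close> uses the pigeonhole principle.\<close>
  define f where "f = restrict f0 V"
  have f: "f \<in> PiE V A" and f_min: "\<And>s b. s \<in> V \<Longrightarrow> b \<in> A s \<Longrightarrow> Q s (f s) \<le> Q s b"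
    using f0 by (auto simp: f_def)
  then have f': "f \<in> Pi V A" by auto
  have v_ge_Q: "Q s (f s) \<le> v s" if "s \<in> V" for s
  proof (rule v_ge[OF that])
    fix q assume q: "walk s q"
    have "Q s (f s) \<le> Q s (snd (q 0))"
      using q that by (intro f_min) (auto simp: walk_def)
    also have "\<dots> \<le> c s (snd (q 0)) + \<beta> * discounted \<beta> (\<lambda>t. q (Suc t))"
      unfolding Q_def using \<beta> v_le[OF walk_shift[OF q, of 1]] q by (simp add: walk_def)
    also have "\<dots> = discounted \<beta> q"
      using discounted_split[OF q \<beta>] q by (simp add: walk_def case_prod_beta)
    finally show "Q s (f s) \<le> discounted \<beta> q" .
  qed
  have "discounted \<beta> (orbit f s) \<le> v s" if "s \<in> V" for s
  proof -
    note w = walk_orbit[OF f' that]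
    \<comment> \<open>The one-step inequality \<open>v_ge_Q\<close> is unrolled along the orbit; as
      \<open>v\<close> is bounded on \<open>V\<close>, the remainder tends to 0.\<close>
    have "(\<Sum>t<n. \<beta> ^ t * case_prod c (orbit f s t)) + \<beta> ^ n * v (fst (orbit f s n)) \<le> v s" for n
    proof (induction n)
      case 0
      then show ?case by (simp add: orbit_def)
    next
      case (Suc n)
      have "\<beta> ^ n * Q (fst (orbit f s n)) (f (fst (orbit f s n))) \<le> \<beta> ^ n * v (fst (orbit f s n))"
        using \<beta> v_ge_Q[OF walk_in[OF w]] by (intro mult_left_mono) auto
      with Suc show ?case
        by (simp add: Q_def orbit_def Let_def algebra_simps)
    qed
    moreover have "(\<lambda>n. (\<Sum>t<n. \<beta> ^ t * case_prod c (orbit f s t)) + \<beta> ^ n * v (fst (orbit f s n)))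
        \<longlonglongrightarrow> discounted \<beta> (orbit f s) + 0"
    proof (rule tendsto_add)
      show "(\<lambda>n. \<Sum>t<n. \<beta> ^ t * case_prod c (orbit f s t)) \<longlonglongrightarrow> discounted \<beta> (orbit f s)"
        unfolding discounted_def by (rule summable_LIMSEQ[OF summable_discounted[OF w \<beta>]])
      show "(\<lambda>n. \<beta> ^ n * v (fst (orbit f s n))) \<longlonglongrightarrow> 0"
      proof (rule Lim_null_comparison)
        show "\<forall>\<^sub>F n in sequentially. norm (\<beta> ^ n * v (fst (orbit f s n))) \<le> \<beta> ^ n * B"
          using v_bound[OF walk_in[OF w]] \<beta> by (auto simp: abs_mult mult_left_mono)
        show "(\<lambda>n. \<beta> ^ n * B) \<longlonglongrightarrow> 0"
          using \<beta> by (intro tendsto_mult_left_zero LIMSEQ_realpow_zero) auto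
      qed
    qed
    ultimately show ?thesis
      using LIMSEQ_le_const2 by (metis (no_types, lifting) add.right_neutral)
  qed
  with f v_le show ?thesis by (metis order_trans walk_def)
qed

text \<open>There are finitely many stationary choices, so one of them recurs as an optimal one.
  This is weaker than Blackwell optimality, but it suffices for a limit along a subsequence.\<close>

lemma ex_discount_optimal_sequence:
  fixes \<beta> :: "nat \<Rightarrow> real"
  assumes "\<And>n. 0 < \<beta> n" "\<And>n. \<beta> n < 1"
  shows "\<exists>f\<in>Pi V A. infinite {n. \<forall>s q. walk s q \<longrightarrow> discounted (\<beta> n) (orbit f s) \<le> discounted (\<beta> n) q}"
proof -
  obtain F where F: "\<And>n. F n \<in> PiE V A"
    "\<And>n s q. walk s q \<Longrightarrow> discounted (\<beta> n) (orbit (F n) s) \<le> discounted (\<beta> n) q"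
    using ex_discount_optimal[OF assms] by metis
  have "finite (range F)"
    using F(1) finite_PiE[OF finite_V finite_A] by (meson finite_subset image_subsetI)
  then obtain m where "infinite {n. F n = F m}"
    using pigeonhole_infinite[of UNIV F] by auto
  moreover have "{n. F n = F m} \<subseteq>
      {n. \<forall>s q. walk s q \<longrightarrow> discounted (\<beta> n) (orbit (F m) s) \<le> discounted (\<beta> n) q}"
    using F(2) by (auto, metis)
  ultimately show ?thesis
    using F(1)[of m] by (meson PiE_iff Pi_I finite_subset)
qed

section \<open>Cutting loops and overtaking\<close>

lemma cost_add: "cost q (t + k) = cost q k + cost (\<lambda>i. q (i + k)) t"
  by (induction t) (simp_all add: cost_def)

lemma cost_cong: "(\<And>i. i < t \<Longrightarrow> q i = q' i) \<Longrightarrow> cost q t = cost q' t"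
  by (simp add: cost_def)

lemma walk_splice:
  assumes "walk s q" "fst (q (t + L)) = fst (q t)"
  shows "walk s (\<lambda>i. if i < t then q i else q (i + L))"
proof -
  let ?q = "\<lambda>i. if i < t then q i else q (i + L)"
  have "fst (?q (Suc i)) = nx (fst (?q i)) (snd (?q i))" for i
  \<comment> \<open>The seam: the action of \<open>q i\<close> leads to the state of
    \<open>q t\<close>, which is that of \<open>q (t + L)\<close>.\<close>
  proof (cases "Suc i = t")
    case True
    with assms show ?thesis by (auto simp: walk_def)
  next
    case False
    with assms show ?thesis by (auto simp: walk_def)
  qed
  with assms show ?thesis
    by (cases t) (auto simp: walk_def)
qed

lemma ex_not_overtaken:
  "\<exists>f\<in>Pi V A. \<forall>s q T. walk s q \<longrightarrow> (\<forall>t\<ge>T. cost q t \<le> cost (orbit f s) t) \<longrightarrow>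
     finite {t. cost q t < cost (orbit f s) t}"
proof -
  \<comment> \<open>The double \<open>Suc\<close> makes \<open>\<beta> 0\<close> equal to 1/2 and so
    keeps all factors positive.\<close>
  define \<beta> :: "nat \<Rightarrow> real" where "\<beta> n = 1 - inverse (real (Suc (Suc n)))" for n
  have \<beta>: "0 < \<beta> n" "\<beta> n < 1" for n by (auto simp: \<beta>_def field_simps)
  have \<beta>_lim: "\<beta> \<longlonglongrightarrow> 1"
    unfolding \<beta>_def using tendsto_diff[OF tendsto_const[of 1] LIMSEQ_Suc[OF LIMSEQ_inverse_real_of_nat]] by simp
  obtain f where f: "f \<in> Pi V A"
    and opt: "infinite {n. \<forall>s q. walk s q \<longrightarrow> discounted (\<beta> n) (orbit f s) \<le> discounted (\<beta> n) q}"
    using ex_discount_optimal_sequence[OF \<beta>] by (rule bexE)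
  define D where "D s q t = cost (orbit f s) t - cost q t" for s q t
  \<comment> \<open>General in \<open>q\<close> and \<open>T\<close>, because it is applied both to
    the given walk and to the spliced walk \<open>r\<close>.\<close>
  have D_null: "D s q \<longlonglongrightarrow> 0" if q: "walk s q" and nn: "\<forall>t\<ge>T. 0 \<le> D s q t" for s q T
  proof -
    define d where "d i = case_prod c (orbit f s i) - case_prod c (q i)" for i
    have D_eq: "D s q = (\<lambda>t. \<Sum>i<t. d i)"
      by (simp add: D_def d_def cost_def sum_subtractf fun_eq_iff)
    have w: "walk s (orbit f s)" using q f by (intro walk_orbit) (auto simp: walk_def)
    obtain C where C: "\<And>s q t. walk s q \<Longrightarrow> \<bar>case_prod c (q t)\<bar> \<le> C" using c_bounded by blast
    show ?thesis
      unfolding D_eq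
    proof (rule vanishing_discount_partial_sums[OF _ \<beta> \<beta>_lim])
      show "\<bar>d k\<bar> \<le> C + C" for k
        unfolding d_def using C[OF w, of k] C[OF q, of k] by (auto simp: abs_le_iff)
      show "infinite {n. (\<Sum>k. \<beta> n ^ k * d k) \<le> 0}"
      proof (rule infinite_super[OF _ opt], safe)
        fix n assume "\<forall>s q. walk s q \<longrightarrow> discounted (\<beta> n) (orbit f s) \<le> discounted (\<beta> n) q"
        then have "discounted (\<beta> n) (orbit f s) \<le> discounted (\<beta> n) q" using q by blast
        then show "(\<Sum>k. \<beta> n ^ k * d k) \<le> 0"
          using suminf_diff[OF summable_discounted[OF w \<beta>, of n] summable_discounted[OF q \<beta>, of n]]
          by (simp add: discounted_def d_def right_diff_distrib)
      qed
      show "0 \<le> (\<Sum>i<t. d i)" if "T \<le> t" for t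
        using nn that by (simp add: D_eq)
    qed
  qed
  have "finite {t. 0 < D s q t}" if q: "walk s q" and nn: "\<forall>t\<ge>T. 0 \<le> D s q t" for s q T
  proof (rule ccontr)
    assume inf: "infinite {t. 0 < D s q t}"
    \<comment> \<open>Recurrence of the first component allows a loop to be cut from
      \<open>q\<close>. Recurrence of the second makes the orbit periodic from then on, so that
      shifting it by the length of the loop does not change its costs.\<close>
    let ?p = "\<lambda>t. (fst (q t), fst (orbit f s t))"
    have w: "walk s (orbit f s)" using q f by (intro walk_orbit) (auto simp: walk_def)
    have fin: "finite (?p ` {t. 0 < D s q t})"
      using walk_in[OF q] walk_in[OF w] finite_V
      by (auto intro!: finite_subset[of "?p ` _" "V \<times> V"])
    obtain t0 where "infinite {t \<in> {t. 0 < D s q t}. ?p t = ?p t0}"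
      using pigeonhole_infinite[OF inf fin] by (rule bexE)
    then have inf0: "infinite {t. 0 < D s q t \<and> ?p t = ?p t0}" by simp
    then obtain t1 where t1: "t1 \<ge> T" "0 < D s q t1" "?p t1 = ?p t0"
      unfolding infinite_nat_iff_unbounded_le by blast
    have "\<forall>\<^sub>F t in sequentially. D s q t < D s q t1"
      using D_null[OF q nn] t1(2) by (rule order_tendstoD(2))
    then obtain n1 where n1: "\<And>t. t \<ge> n1 \<Longrightarrow> D s q t < D s q t1"
      by (auto simp: eventually_sequentially)
    \<comment> \<open>Since \<open>D\<close> tends to 0 and \<open>D s q t1\<close> is positive, a
      sufficiently late recurrence has a strictly smaller value.\<close>
    obtain t2 where t2: "t2 \<ge> max n1 (Suc t1)" "0 < D s q t2" "?p t2 = ?p t0"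
      using inf0 unfolding infinite_nat_iff_unbounded_le by blast
    define L where "L = t2 - t1"
    have t2_eq: "t2 = t1 + L" using t2 by (simp add: L_def)
    define \<epsilon> where "\<epsilon> = D s q t1 - D s q t2"
    have \<epsilon>: "\<epsilon> > 0" using n1[of t2] t2 by (simp add: \<epsilon>_def)
    \<comment> \<open>Between \<open>t1\<close> and \<open>t2\<close> the walk \<open>q\<close> closes a loop that costs \<open>\<epsilon>\<close> more than the orbit does;
      without it the walk is ahead of the orbit by at least \<open>\<epsilon>\<close> from \<open>t1\<close> on.\<close>
    define r where "r i = (if i < t1 then q i else q (i + L))" for i
    have r: "walk s r"
      unfolding r_def using q t1 t2 by (intro walk_splice) (auto simp: t2_eq)
    have orb: "orbit f s (i + L) = orbit f s i" if "i \<ge> t1" for i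
    proof -
      have "orbit f s (i + L) = orbit f s ((i - t1) + t2)" "orbit f s i = orbit f s ((i - t1) + t1)"
        using that by (simp_all add: t2_eq)
      then show ?thesis
        using t1 t2 by (simp only: orbit_add) simp
    qed
    \<comment> \<open>After \<open>t1\<close>, both \<open>r\<close> and the orbit incur the costs
      that \<open>q\<close> and the orbit incur after \<open>t2\<close>. The two differences thus
      differ by \<open>D s q t1 - D s q t2\<close>.\<close>
    have D_r: "D s r (k + t1) = D s q (k + t1 + L) + \<epsilon>" for k
    proof -
      have "cost r (k + t1) = cost q t1 + cost (\<lambda>i. q (i + t2)) k"
        unfolding cost_add by (rule arg_cong2[where f = "(+)"]; rule cost_cong)
          (simp_all add: r_def t2_eq ac_simps)
      moreover have "cost (orbit f s) (k + t1) = cost (orbit f s) t1 + cost (\<lambda>i. orbit f s (i + t2)) k"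
        unfolding cost_add using orb
        by (intro arg_cong2[where f = "(+)"] cost_cong refl) (metis add.assoc le_add2 t2_eq)
      moreover have "k + t1 + L = k + t2" by (simp add: t2_eq)
      ultimately show ?thesis
        by (simp only: D_def \<epsilon>_def cost_add)
    qed
    have ge: "D s r t \<ge> \<epsilon>" if "t \<ge> t1" for t
      using D_r[of "t - t1"] nn that t1(1) by simp
    \<comment> \<open>The bound \<open>ge\<close> makes \<open>r\<close> itself subject to
      \<open>D_null\<close>, although its difference stays at least
      \<open>\<epsilon>\<close>.\<close>
    then have "D s r \<longlonglongrightarrow> 0"
      using \<epsilon> by (intro D_null[OF r, of t1]) (auto intro: order_trans less_imp_le)
    then have "\<epsilon> \<le> 0"
      using ge by (intro LIMSEQ_le_const) auto
    with \<epsilon> show False by simp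
  qed
  then show ?thesis
    using f by (intro bexI[of _ f]) (auto simp: D_def)
qed

end

subsection \<open>Ionescu-Tulcea measures with a single surviving path\<close>

context Ionescu_Tulcea
begin

lemma emeasure_lim_prefix:
  assumes "X \<in> sets (PiM {0..<n} M)"
  shows "emeasure PF.lim (prod_emb UNIV M {0..<n} X) = emeasure (C 0 n (\<lambda>_. undefined)) X"
  using assms lim[of "{0..<n}" X] emeasure_CI[of "{0..<n}" n X] sets.sets_into_space[OF assms]
  by (simp add: space_PiM prod_emb_id)

text \<open>The measure at stage \<open>Suc n\<close> is the bind of that at stage \<open>n\<close>
  with \<open>eP n\<close>, which appends coordinate \<open>n\<close> drawn from
  \<open>P n\<close>.\<close>

lemma emeasure_C_Suc:
  assumes "X \<in> sets (PiM {0..<Suc n} M)"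
  shows "emeasure (C 0 (Suc n) (\<lambda>_. undefined)) X =
    (\<integral>\<^sup>+\<omega>. emeasure (P n \<omega>) ((\<lambda>x. fun_upd \<omega> n x) -` X \<inter> space (M n)) \<partial>C 0 n (\<lambda>_. undefined))"
proof -
  have u: "(\<lambda>_. undefined) \<in> space (PiM {0..<0} M)" by simp
  have "emeasure (C 0 (Suc n) (\<lambda>_. undefined)) X =
      (\<integral>\<^sup>+\<omega>. emeasure (eP n \<omega>) X \<partial>C 0 n (\<lambda>_. undefined))"
    using prob_space.not_empty[OF prob_space_C[OF u]] assms measurable_eP[of n] sets_C[OF u, of n]
    by (simp, subst emeasure_bind[where N = "PiM {0..<Suc n} M"])
       (auto cong: measurable_cong_sets)
  also have "\<dots> = (\<integral>\<^sup>+\<omega>. emeasure (P n \<omega>) ((\<lambda>x. fun_upd \<omega> n x) -` X \<inter> space (M n)) \<partial>C 0 n (\<lambda>_. undefined))"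
    using assms space_C[OF u, of n] by (intro nn_integral_cong emeasure_eP) auto
  finally show ?thesis .
qed

text \<open>Prefixes that stay in \<open>S\<close> but deviate from \<open>q\<close> are null, and
  along \<open>q\<close> step \<open>n\<close> multiplies the mass by \<open>W n\<close>. The kernel
  is constrained only while all earlier weights are positive: after a zero weight \<open>q\<close>
  may be meaningless, but no mass is left in \<open>S\<close>.\<close>

lemma emeasure_lim_single_path:
  assumes M: "M = (\<lambda>_. count_space UNIV)"
    and W: "\<And>n \<omega>. (\<And>i. i < n \<Longrightarrow> \<omega> i = q i) \<Longrightarrow> (\<And>i. i < n \<Longrightarrow> 0 < W i) \<Longrightarrow>
       emeasure (P n \<omega>) S = ennreal (W n)"
    and q: "\<And>n \<omega>. (\<And>i. i < n \<Longrightarrow> \<omega> i = q i) \<Longrightarrow> (\<And>i. i < n \<Longrightarrow> 0 < W i) \<Longrightarrow>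
       emeasure (P n \<omega>) (S - {q n}) = 0"
    and W_nonneg: "\<And>n. 0 \<le> W n"
  shows "emeasure PF.lim {\<omega>. \<forall>i<n. \<omega> i \<in> S} = ennreal (\<Prod>i<n. W i)"
proof -
  let ?C = "\<lambda>n. C 0 n (\<lambda>_. undefined)"
  define E where "E n = PiE {0..<n} (\<lambda>_. S)" for n :: nat
  \<comment> \<open>The intersection matters because \<open>q i\<close> need not lie in
    \<open>S\<close>.\<close>
  define G where "G n = PiE {0..<n} (\<lambda>i. S \<inter> {q i})" for n :: nat
  have E[measurable]: "E n \<in> sets (PiM {0..<n} M)" for n
    unfolding E_def by (rule sets_PiM_I_finite) (simp_all add: M)
  have G[measurable]: "G n \<in> sets (PiM {0..<n} M)" for n
    unfolding G_def by (rule sets_PiM_I_finite) (simp_all add: M)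
  have sC: "sets (?C n) = sets (PiM {0..<n} M)" "space (?C n) = space (PiM {0..<n} M)" for n
    using sets_C[of _ 0 n] space_C[of _ 0 n] by (simp_all)
  have sP: "sets (P n \<omega>) = UNIV" if "\<omega> \<in> space (?C n)" for n \<omega>
    using sets_P[of \<omega> n] that by (simp add: sC(2)) (simp add: M)
  have upd_E: "fun_upd \<omega> n x \<in> E (Suc n) \<longleftrightarrow> \<omega> \<in> E n \<and> x \<in> S" if "\<omega> \<in> space (?C n)" for \<omega> n x
    using that by (auto simp: sC E_def space_PiM PiE_iff extensional_def less_Suc_eq)
  have upd_G: "fun_upd \<omega> n x \<in> G (Suc n) \<longleftrightarrow> \<omega> \<in> G n \<and> x \<in> S \<inter> {q n}" if "\<omega> \<in> space (?C n)" for \<omega> n x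
    using that by (auto simp: sC G_def space_PiM PiE_iff extensional_def less_Suc_eq)
  have GE: "G n \<subseteq> E n" for n by (auto simp: G_def E_def PiE_iff)
  have G_q: "\<omega> i = q i" if "\<omega> \<in> G n" "i < n" for \<omega> n i
    using that by (auto simp: G_def PiE_iff)
  have main: "emeasure (?C n) (E n - G n) = 0 \<and> emeasure (?C n) (G n) = ennreal (\<Prod>i<n. W i)" for n
  proof (induction n)
    case 0
    have E0: "E 0 = {\<lambda>_. undefined}" and G0: "G 0 = {\<lambda>_. undefined}" by (auto simp: E_def G_def)
    have "emeasure (return (PiM {0..<0} M) (\<lambda>_. undefined)) (G 0) = 1"
      using G[of 0] G0 by (subst emeasure_return) auto
    then show ?case using E0 G0 by simp
  next
    case (Suc n)
    have bad: "AE \<omega> in ?C n. \<omega> \<notin> E n - G n"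
      using Suc E[of n] G[of n] by (intro AE_not_in) (auto simp: null_sets_def sC)
    \<comment> \<open>If some earlier weight is 0, then \<open>G n\<close> is null; so the
      hypotheses \<open>W\<close> and \<open>q\<close> apply almost everywhere on
      \<open>G n\<close>.\<close>
    have dead: "AE \<omega> in ?C n. \<omega> \<in> G n \<longrightarrow> (\<forall>i<n. 0 < W i)"
    proof (cases "\<forall>i<n. 0 < W i")
      case False
      then have "(\<Prod>i<n. W i) = 0" using W_nonneg by (force simp: less_le)
      with Suc have "emeasure (?C n) (G n) = 0" by simp
      then have "AE \<omega> in ?C n. \<omega> \<notin> G n"
        using G[of n] by (intro AE_not_in null_setsI) (simp_all add: sC)
      then show ?thesis by eventually_elim auto
    qed auto
    have sM: "space (M n) = UNIV" by (simp add: M)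
    have "emeasure (?C (Suc n)) (E (Suc n) - G (Suc n)) = (\<integral>\<^sup>+\<omega>. 0 \<partial>?C n)"
    proof (subst emeasure_C_Suc)
      show "(\<integral>\<^sup>+\<omega>. emeasure (P n \<omega>) (fun_upd \<omega> n -` (E (Suc n) - G (Suc n)) \<inter> space (M n)) \<partial>?C n) =
          (\<integral>\<^sup>+\<omega>. 0 \<partial>?C n)"
      proof (rule nn_integral_cong_AE)
        show "AE \<omega> in ?C n. emeasure (P n \<omega>) (fun_upd \<omega> n -` (E (Suc n) - G (Suc n)) \<inter> space (M n)) = 0"
          using bad dead AE_space
        proof eventually_elim
          case (elim \<omega>)
          show ?case
          proof (cases "\<omega> \<in> G n")
            case True
            then have "fun_upd \<omega> n -` (E (Suc n) - G (Suc n)) \<inter> space (M n) = S - {q n}"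
              using GE[of n] elim(3) by (auto simp: upd_E upd_G sM)
            with True elim(2) show ?thesis by (simp add: q G_q)
          next
            case False
            then have "fun_upd \<omega> n -` (E (Suc n) - G (Suc n)) \<inter> space (M n) = {}"
              using elim by (auto simp: upd_E upd_G)
            then show ?thesis by simp
          qed
        qed
      qed
    qed (intro sets.Diff E G)
    moreover have "emeasure (?C (Suc n)) (G (Suc n)) = (\<integral>\<^sup>+\<omega>. ennreal (W n) * indicator (G n) \<omega> \<partial>?C n)"
    proof (subst emeasure_C_Suc)
      show "(\<integral>\<^sup>+\<omega>. emeasure (P n \<omega>) (fun_upd \<omega> n -` G (Suc n) \<inter> space (M n)) \<partial>?C n) =
          (\<integral>\<^sup>+\<omega>. ennreal (W n) * indicator (G n) \<omega> \<partial>?C n)"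
      proof (rule nn_integral_cong_AE)
        show "AE \<omega> in ?C n. emeasure (P n \<omega>) (fun_upd \<omega> n -` G (Suc n) \<inter> space (M n)) =
            ennreal (W n) * indicator (G n) \<omega>"
          using dead AE_space
        proof eventually_elim
          case (elim \<omega>)
          have eq: "fun_upd \<omega> n -` G (Suc n) \<inter> space (M n) = (if \<omega> \<in> G n then S \<inter> {q n} else {})"
            using elim(2) by (auto simp: upd_G sM)
          show ?case
          proof (cases "\<omega> \<in> G n")
            case True
            have "emeasure (P n \<omega>) (S \<inter> {q n}) + emeasure (P n \<omega>) (S - {q n}) = emeasure (P n \<omega>) S"
              by (subst plus_emeasure) (auto simp: sP[OF elim(2)] intro!: arg_cong[where f = "emeasure _"])
            with True elim(1) eq show ?thesis by (simp add: q W G_q)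
          qed (simp add: eq)
        qed
      qed
    qed (rule G)
    moreover have "\<dots> = ennreal (W n) * emeasure (?C n) (G n)"
      by (rule nn_integral_cmult_indicator) (simp add: sC)
    ultimately show ?case
      using Suc W_nonneg by (simp add: ennreal_mult[symmetric] prod_nonneg mult.commute)
  qed
  have "{\<omega>. \<forall>i<n. \<omega> i \<in> S} = prod_emb UNIV M {0..<n} (E n)"
    by (auto simp: prod_emb_def E_def M PiE_iff)
  then have "emeasure PF.lim {\<omega>. \<forall>i<n. \<omega> i \<in> S} = emeasure (?C n) (E n)"
    using emeasure_lim_prefix[OF E] by simp
  also have "\<dots> = emeasure (?C n) (E n - G n) + emeasure (?C n) (G n)"
    using E[of n] G[of n] GE[of n] by (subst plus_emeasure) (auto simp: sC intro!: arg_cong[where f = "emeasure _"])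
  also have "\<dots> = ennreal (\<Prod>i<n. W i)" using main by simp
  finally show ?thesis .
qed

end

subsection \<open>Survival under pure strategies\<close>

definition survival :: "('s, 'a) safety_mdp \<Rightarrow> 's \<Rightarrow> 'a \<Rightarrow> real" where
  "survival M s a = 1 - pmf (tprob M s a) (avoid M)"

text \<open>Arbitrary if the state to be avoided is reached with probability 1.\<close>
definition live_succ :: "('s, 'a) safety_mdp \<Rightarrow> 's \<Rightarrow> 'a \<Rightarrow> 's" where
  "live_succ M s a = (SOME z. z \<in> set_pmf (tprob M s a) \<and> z \<noteq> avoid M)"

definition chosen :: "('s, 'a) strat \<Rightarrow> ('s, 'a) hist \<Rightarrow> 'a" where
  "chosen \<sigma> h = (SOME a. pmf (\<sigma> h) a = 1)"

text \<open>The history under a pure strategy, conditioned on the avoided state not being reached.\<close>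
primrec live_hist :: "('s, 'a) safety_mdp \<Rightarrow> 's \<Rightarrow> ('s, 'a) strat \<Rightarrow> nat \<Rightarrow> ('s, 'a) hist" where
  "live_hist M s \<sigma> 0 = ([], s)"
| "live_hist M s \<sigma> (Suc n) = (let h = live_hist M s \<sigma> n; a = chosen \<sigma> h in
     (fst h @ [(snd h, a)], live_succ M (snd h) a))"

definition live_play :: "('s, 'a) safety_mdp \<Rightarrow> 's \<Rightarrow> ('s, 'a) strat \<Rightarrow> nat \<Rightarrow> 's \<times> 'a" where
  "live_play M s \<sigma> n = (snd (live_hist M s \<sigma> n), chosen \<sigma> (live_hist M s \<sigma> n))"

lemma live_hist_Suc: "live_hist M s \<sigma> (Suc n) =
    (fst (live_hist M s \<sigma> n) @ [live_play M s \<sigma> n], case_prod (live_succ M) (live_play M s \<sigma> n))"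
  by (simp add: live_play_def Let_def)

lemma fst_live_hist: "fst (live_hist M s \<sigma> n) = map (live_play M s \<sigma>) [0..<n]"
  by (induction n) (simp_all add: live_hist_Suc del: live_hist.simps(2))

lemma fst_live_play_Suc:
  "fst (live_play M s \<sigma> (Suc n)) = case_prod (live_succ M) (live_play M s \<sigma> n)"
  by (simp add: live_play_def Let_def)

lemma survival_nonneg: "0 \<le> survival M s a"
  by (simp add: survival_def pmf_le_1)

lemma pmf_eq_1_iff: "pmf p a = 1 \<longleftrightarrow> p = return_pmf a"
proof
  assume "pmf p a = 1"
  then have "measure_pmf.prob p {a} = 1" by (simp add: measure_pmf_single)
  then have "set_pmf p \<subseteq> {a}" by (simp add: measure_pmf.prob_eq_1 AE_measure_pmf_iff subset_eq)
  then show "p = return_pmf a" by (simp add: set_pmf_subset_singleton)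
qed simp

lemma chosen_eq:
  assumes "strategy M \<sigma>" "pure M \<sigma>" "history M h"
  shows "\<sigma> h = return_pmf (chosen \<sigma> h)" "chosen \<sigma> h \<in> actions M (snd h)"
proof -
  have "\<exists>a. pmf (\<sigma> h) a = 1" using assms unfolding pure_def by blast
  then have "pmf (\<sigma> h) (chosen \<sigma> h) = 1" unfolding chosen_def by (rule someI_ex)
  then show eq: "\<sigma> h = return_pmf (chosen \<sigma> h)" by (simp add: pmf_eq_1_iff)
  have "set_pmf (\<sigma> h) \<subseteq> actions M (snd h)" using assms unfolding strategy_def by blast
  then show "chosen \<sigma> h \<in> actions M (snd h)" by (subst (asm) eq) simp
qed

lemma history_Nil: "history M ([], s) \<longleftrightarrow> s \<in> states M"
  by (simp add: history_def)

lemma history_snoc: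
  "history M (xs @ [(z, a)], y) \<longleftrightarrow>
     history M (xs, z) \<and> a \<in> actions M z \<and> y \<in> states M \<and> y \<in> set_pmf (tprob M z a)"
proof -
  let ?Q = "\<lambda>xs s i. pmf (tprob M (fst (xs ! i)) (snd (xs ! i))) ((map fst xs @ [s]) ! Suc i) > 0"
  have "?Q (xs @ [(z, a)]) y i \<longleftrightarrow> ?Q xs z i" if "i < length xs" for i
    using that by (simp add: nth_append)
  moreover have "?Q (xs @ [(z, a)]) y (length xs) \<longleftrightarrow> y \<in> set_pmf (tprob M z a)"
    by (simp add: nth_append pmf_positive_iff)
  ultimately have "(\<forall>i<length (xs @ [(z, a)]). ?Q (xs @ [(z, a)]) y i) \<longleftrightarrow>
      (\<forall>i<length xs. ?Q xs z i) \<and> y \<in> set_pmf (tprob M z a)"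
    by (simp only: length_append_singleton All_less_Suc) blast
  then show ?thesis
    by (simp only: history_def case_prod_conv set_append list.set ball_Un ball_simps) blast
qed

section \<open>Kernels and hitting probabilities along the live play\<close>

context
  fixes M :: "('s, 'a) safety_mdp"
  assumes mdp: "is_safety_mdp M" and det: "deterministic M"
begin

lemma set_tprob_states:
  "s \<in> states M \<Longrightarrow> a \<in> actions M s \<Longrightarrow> set_pmf (tprob M s a) \<subseteq> states M"
  using mdp by (auto simp: is_safety_mdp_def)

text \<open>Here determinism enters: the support has at most one state other than the avoided one,
  so the choice in \<open>live_succ\<close> is unambiguous.\<close>

lemma set_tprob_live:
  assumes "s \<in> states M - {avoid M}" "a \<in> actions M s" "z \<in> set_pmf (tprob M s a)" "z \<noteq> avoid M"
  shows "z = live_succ M s a"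
proof -
  obtain y where "measure_pmf.prob (tprob M s a) {y, avoid M} = 1"
    using det assms unfolding deterministic_def by blast
  then have sub: "set_pmf (tprob M s a) \<subseteq> {y, avoid M}"
    by (simp add: measure_pmf.prob_eq_1 AE_measure_pmf_iff subset_eq)
  have "live_succ M s a \<in> set_pmf (tprob M s a) \<and> live_succ M s a \<noteq> avoid M"
    unfolding live_succ_def by (rule someI[of _ z]) (use assms in simp)
  with sub assms show ?thesis by auto
qed

lemma live_succ_in:
  assumes "s \<in> states M" "a \<in> actions M s" "0 < survival M s a"
  shows "live_succ M s a \<in> set_pmf (tprob M s a)" "live_succ M s a \<in> states M - {avoid M}"
proof -
  have "\<not> set_pmf (tprob M s a) \<subseteq> {avoid M}"
    using assms(3) by (auto simp: set_pmf_subset_singleton survival_def)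
  then have "\<exists>z. z \<in> set_pmf (tprob M s a) \<and> z \<noteq> avoid M" by blast
  from someI_ex[OF this] show "live_succ M s a \<in> set_pmf (tprob M s a)"
      "live_succ M s a \<in> states M - {avoid M}"
    using set_tprob_states[OF assms(1,2)] by (auto simp: live_succ_def)
qed

lemma live_hist_history:
  assumes "strategy M \<sigma>" "pure M \<sigma>" "s \<in> states M - {avoid M}"
    and "\<And>i. i < n \<Longrightarrow> 0 < case_prod (survival M) (live_play M s \<sigma> i)"
  shows "history M (live_hist M s \<sigma> n) \<and> snd (live_hist M s \<sigma> n) \<in> states M - {avoid M}"
  using assms(4)
proof (induction n)
  case 0
  then show ?case using assms by (simp add: history_Nil)
next
  case (Suc n)
  define h where "h = live_hist M s \<sigma> n"
  from Suc have h: "history M (fst h, snd h)" "snd h \<in> states M - {avoid M}" by (simp_all add: h_def)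
  have a: "chosen \<sigma> h \<in> actions M (snd h)"
    using chosen_eq(2)[OF assms(1,2)] h by simp
  moreover have "0 < survival M (snd h) (chosen \<sigma> h)"
    using Suc.prems[of n] by (simp add: live_play_def h_def)
  ultimately show ?case
    using live_succ_in[of "snd h" "chosen \<sigma> h"] h
    by (simp add: Let_def h_def[symmetric] history_snoc)
qed

text \<open>Coordinate \<open>n\<close> results from transition \<open>n - 1\<close>, hence the
  shifted weight, which is 1 at the start. Transition \<open>n - 1\<close> itself may have survival
  probability 0; then only the avoided state is drawn and the second claim is vacuous.\<close>

lemma play_kernel_live:
  assumes \<sigma>: "strategy M \<sigma>" "pure M \<sigma>" and s: "s \<in> states M - {avoid M}"
    and \<omega>: "\<And>i. i < n \<Longrightarrow> \<omega> i = live_play M s \<sigma> i"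
    and live: "\<And>i. Suc i < n \<Longrightarrow> 0 < case_prod (survival M) (live_play M s \<sigma> i)"
  shows "emeasure (play_kernel M s \<sigma> n \<omega>) {x. fst x \<noteq> avoid M} =
      ennreal (case n of 0 \<Rightarrow> 1 | Suc m \<Rightarrow> case_prod (survival M) (live_play M s \<sigma> m))"
    and "emeasure (play_kernel M s \<sigma> n \<omega>) ({x. fst x \<noteq> avoid M} - {live_play M s \<sigma> n}) = 0"
proof -
  define xs where "xs = map (live_play M s \<sigma>) [0..<n]"
  have xs: "map \<omega> [0..<n] = xs" using \<omega> by (simp add: xs_def)
  let ?N = "next_state M s xs"
  \<comment> \<open>That every possible \<open>z\<close> completes a history has two uses: the
    kernel is not in its default branch, and the strategy picks \<open>chosen\<close> there.\<close>
  have N: "measure_pmf.prob ?N (- {avoid M}) =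
        (case n of 0 \<Rightarrow> 1 | Suc m \<Rightarrow> case_prod (survival M) (live_play M s \<sigma> m)) \<and>
      (\<forall>z\<in>set_pmf ?N. history M (xs, z) \<and> (z \<noteq> avoid M \<longrightarrow> (xs, z) = live_hist M s \<sigma> n))"
  proof (cases n)
    case 0
    then show ?thesis
      using s by (simp add: xs_def next_state_def history_Nil)
  next
    case (Suc m)
    define h where "h = live_hist M s \<sigma> m"
    have h: "history M (fst h, snd h)" "snd h \<in> states M - {avoid M}"
      using live_hist_history[OF \<sigma> s, of m] live by (simp_all add: h_def Suc)
    have a: "chosen \<sigma> h \<in> actions M (snd h)"
      using chosen_eq(2)[OF \<sigma>] h by simp
    have p: "live_play M s \<sigma> m = (snd h, chosen \<sigma> h)" by (simp add: live_play_def h_def)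
    have xs_eq: "xs = fst h @ [(snd h, chosen \<sigma> h)]"
      by (simp add: xs_def Suc fst_live_hist h_def p[unfolded h_def])
    have "?N = tprob M (snd h) (chosen \<sigma> h)"
      by (simp add: next_state_def xs_eq)
    moreover have "measure_pmf.prob (tprob M (snd h) (chosen \<sigma> h)) (- {avoid M}) =
        survival M (snd h) (chosen \<sigma> h)"
      using measure_pmf.prob_compl[of "{avoid M}"]
      by (simp add: survival_def Compl_eq_Diff_UNIV measure_pmf_single)
    moreover have "history M (xs, z)" if "z \<in> set_pmf (tprob M (snd h) (chosen \<sigma> h))" for z
      using that h a set_tprob_states[of "snd h" "chosen \<sigma> h"] by (auto simp: xs_eq history_snoc)
    moreover have "(xs, z) = live_hist M s \<sigma> n"
      if "z \<in> set_pmf (tprob M (snd h) (chosen \<sigma> h))" "z \<noteq> avoid M" for z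
      using set_tprob_live[OF h(2) a that] by (simp add: Suc Let_def h_def[symmetric] xs_eq)
    ultimately show ?thesis
      by (simp add: Suc p)
  qed
  define K where "K = bind_pmf ?N (\<lambda>z. map_pmf (\<lambda>a. (z, a)) (\<sigma> (xs, z)))"
  have "\<exists>z. history M (xs, z)" using N set_pmf_not_empty by (metis ex_in_conv)
  then have K: "play_kernel M s \<sigma> n \<omega> = measure_pmf K"
    by (simp add: play_kernel_def xs K_def)
  have "map_pmf fst K = ?N"
    by (simp add: K_def map_bind_pmf pmf.map_comp comp_def bind_return_pmf')
  then have "emeasure (measure_pmf K) {x. fst x \<noteq> avoid M} = emeasure (measure_pmf ?N) (- {avoid M})"
    by (simp flip: \<open>map_pmf fst K = ?N\<close> add: vimage_def Compl_eq)
  then show "emeasure (play_kernel M s \<sigma> n \<omega>) {x. fst x \<noteq> avoid M} =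
      ennreal (case n of 0 \<Rightarrow> 1 | Suc m \<Rightarrow> case_prod (survival M) (live_play M s \<sigma> m))"
    using N by (simp add: K measure_pmf.emeasure_eq_measure)
  have "set_pmf K \<inter> ({x. fst x \<noteq> avoid M} - {live_play M s \<sigma> n}) = {}"
  proof -
    have "x = live_play M s \<sigma> n" if "x \<in> set_pmf K" "fst x \<noteq> avoid M" for x
    proof -
      from that(1) obtain z a where z: "z \<in> set_pmf ?N" "a \<in> set_pmf (\<sigma> (xs, z))" "x = (z, a)"
        by (auto simp: K_def)
      with N that(2) have "history M (xs, z)" "(xs, z) = live_hist M s \<sigma> n" by auto
      moreover from this(1) z have "a = chosen \<sigma> (xs, z)" using chosen_eq(1)[OF \<sigma>] by force
      ultimately show ?thesis using z by (metis live_play_def snd_conv)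
    qed
    then show ?thesis by blast
  qed
  then show "emeasure (play_kernel M s \<sigma> n \<omega>) ({x. fst x \<noteq> avoid M} - {live_play M s \<sigma> n}) = 0"
    unfolding K by (simp add: measure_pmf.emeasure_eq_measure measure_pmf_zero_iff)
qed

text \<open>A hitting time at most \<open>Suc n\<close> concerns the first \<open>Suc n\<close> states, hence the first \<open>n\<close> transitions.\<close>
lemma hit_prob_Suc:
  assumes \<sigma>: "strategy M \<sigma>" "pure M \<sigma>" and s: "s \<in> states M - {avoid M}"
  shows "hit_prob M s \<sigma> (Suc n) = 1 - (\<Prod>i<n. case_prod (survival M) (live_play M s \<sigma> i))"
proof -
  interpret IT: Ionescu_Tulcea "play_kernel M s \<sigma>" play_space
    by (rule Ionescu_Tulcea_play_kernel[OF mdp])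
  \<comment> \<open>The weight at 0 belongs to the initial state; it turns \<open>Suc n\<close>
    coordinates into \<open>n\<close> transitions.\<close>
  define W where "W n = (case n of 0 \<Rightarrow> 1 | Suc m \<Rightarrow> case_prod (survival M) (live_play M s \<sigma> m))" for n
  have W_Suc: "W (Suc m) = case_prod (survival M) (live_play M s \<sigma> m)" for m by (simp add: W_def)
  have W_nonneg: "0 \<le> W n" for n
    by (simp add: W_def survival_nonneg case_prod_beta split: nat.split)
  let ?S = "{\<omega>. \<forall>i<Suc n. \<omega> i \<in> {x. fst x \<noteq> avoid M}}"
  let ?\<mu> = "play_measure M s \<sigma>"
  have "emeasure ?\<mu> ?S = ennreal (\<Prod>i<Suc n. W i)"
    unfolding play_measure_def
  proof (rule IT.emeasure_lim_single_path[where q = "live_play M s \<sigma>"])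
    fix n \<omega>
    assume \<omega>: "\<And>i. i < n \<Longrightarrow> \<omega> i = live_play M s \<sigma> i" and "\<And>i. i < n \<Longrightarrow> 0 < W i"
    then have live: "\<And>i. Suc i < n \<Longrightarrow> 0 < case_prod (survival M) (live_play M s \<sigma> i)"
      by (metis W_Suc)
    show "emeasure (play_kernel M s \<sigma> n \<omega>) {x. fst x \<noteq> avoid M} = ennreal (W n)"
      unfolding W_def by (rule play_kernel_live[OF \<sigma> s \<omega> live])
    show "emeasure (play_kernel M s \<sigma> n \<omega>) ({x. fst x \<noteq> avoid M} - {live_play M s \<sigma> n}) = 0"
      by (rule play_kernel_live[OF \<sigma> s \<omega> live])
  qed (simp_all add: W_nonneg)
  then have S: "measure ?\<mu> ?S = (\<Prod>i<Suc n. W i)"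
    using W_nonneg by (simp add: measure_def prod_nonneg)
  have sets: "sets ?\<mu> = sets (PiM UNIV play_space)" and space: "space ?\<mu> = UNIV"
    by (simp_all add: play_measure_def space_PiM)
  interpret \<mu>: prob_space ?\<mu>
  proof
    \<comment> \<open>The whole space is the cylinder over the empty set of coordinates.\<close>
    have "emeasure ?\<mu> (prod_emb UNIV play_space {0..<0} {\<lambda>_. undefined}) = 1"
      unfolding play_measure_def
      using IT.emeasure_lim_prefix[of "{\<lambda>_. undefined}" 0] by (simp add: sets_PiM_empty)
    then show "emeasure ?\<mu> (space ?\<mu>) = 1"
      by (simp add: space prod_emb_def restrict_def)
  qed
  have "{\<omega> \<in> space ?\<mu>. hit_time M \<omega> \<le> enat (Suc n)} \<in> sets ?\<mu>"
    using hit_event_measurable[of M "Suc n"] by (simp add: sets space space_PiM)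
  moreover have "?S = space ?\<mu> - {\<omega> \<in> space ?\<mu>. hit_time M \<omega> \<le> enat (Suc n)}"
    by (auto simp: space hit_time_le_iff)
  ultimately have "measure ?\<mu> ?S = 1 - hit_prob M s \<sigma> (Suc n)"
    by (simp only: \<mu>.prob_compl hit_prob_def)
  moreover have "(\<Prod>i<Suc n. W i) = (\<Prod>i<n. case_prod (survival M) (live_play M s \<sigma> i))"
    by (subst prod.lessThan_Suc_shift) (simp add: W_Suc, simp add: W_def)
  ultimately show ?thesis using S by simp
qed

lemma weakly_overtakes_survival:
  assumes \<sigma>: "strategy M \<sigma>" "pure M \<sigma>" and \<sigma>': "strategy M \<sigma>'" "pure M \<sigma>'"
    and s: "s \<in> states M - {avoid M}" and over: "weakly_overtakes M s \<sigma>' \<sigma>"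
  defines "P \<equiv> \<lambda>\<sigma> n. \<Prod>i<n. case_prod (survival M) (live_play M s \<sigma> i)"
  shows "\<exists>T. \<forall>n\<ge>T. P \<sigma> n \<le> P \<sigma>' n" "infinite {n. P \<sigma> n < P \<sigma>' n}"
proof -
  note hp = hit_prob_Suc[OF \<sigma> s, folded P_def] hit_prob_Suc[OF \<sigma>' s, folded P_def]
  obtain T where T: "\<And>t. t \<ge> T \<Longrightarrow> hit_prob M s \<sigma>' t \<le> hit_prob M s \<sigma> t"
    using over by (auto simp: weakly_overtakes_def)
  have "P \<sigma> n \<le> P \<sigma>' n" if "n \<ge> T" for n
    using T[of "Suc n"] that by (simp add: hp P_def)
  then show "\<exists>T. \<forall>n\<ge>T. P \<sigma> n \<le> P \<sigma>' n" by blast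
  have "infinite {t. hit_prob M s \<sigma>' t < hit_prob M s \<sigma> t}"
    using over by (simp add: weakly_overtakes_def)
  \<comment> \<open>\<open>hit_prob_Suc\<close> does not cover \<open>t = 0\<close>, a single time
    that cannot affect infiniteness.\<close>
  moreover have "{t. hit_prob M s \<sigma>' t < hit_prob M s \<sigma> t} \<subseteq> insert 0 (Suc ` {n. P \<sigma> n < P \<sigma>' n})"
  proof
    fix t assume "t \<in> {t. hit_prob M s \<sigma>' t < hit_prob M s \<sigma> t}"
    then show "t \<in> insert 0 (Suc ` {n. P \<sigma> n < P \<sigma>' n})"
      by (cases t) (auto simp: hp P_def)
  qed
  ultimately show "infinite {n. P \<sigma> n < P \<sigma>' n}"
    by (meson finite_imageI finite_insert finite_subset)
qed

section \<open>The finite graph of live states\<close>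

definition live_path :: "(nat \<Rightarrow> 's \<times> 'a) \<Rightarrow> bool" where
  "live_path q \<longleftrightarrow> (\<forall>t. fst (q t) \<in> states M - {avoid M} \<and> snd (q t) \<in> actions M (fst (q t)) \<and>
     0 < case_prod (survival M) (q t) \<and> fst (q (Suc t)) = case_prod (live_succ M) (q t))"

text \<open>Asking for an infinite live path, not just one edge of positive survival, gives every
  live state an edge to a live state, as \<open>cost_graph\<close> demands.\<close>

definition live_states :: "'s set" where
  "live_states = {fst (q 0) |q. live_path q}"

definition live_actions :: "'s \<Rightarrow> 'a set" where
  "live_actions s = {a \<in> actions M s. 0 < survival M s a \<and> live_succ M s a \<in> live_states}"

lemma live_path_in: "live_path q \<Longrightarrow> fst (q t) \<in> live_states"
  unfolding live_states_def live_path_def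
  by (intro CollectI exI[of _ "\<lambda>i. q (i + t)"]) auto

lemma live_path_act: "live_path q \<Longrightarrow> snd (q t) \<in> live_actions (fst (q t))"
  using live_path_in[of q "Suc t"] by (auto simp: live_actions_def live_path_def case_prod_beta)

lemma live_states_sub: "live_states \<subseteq> states M - {avoid M}"
  by (auto simp: live_states_def live_path_def)

lemma cost_graph_live:
  "cost_graph live_states live_actions (live_succ M)"
proof
  show "finite live_states"
    using live_states_sub mdp by (auto simp: is_safety_mdp_def intro: finite_subset)
  fix s assume s: "s \<in> live_states"
  then show "finite (live_actions s)"
    using live_states_sub mdp by (auto simp: is_safety_mdp_def live_actions_def)
  show "live_actions s \<noteq> {}"
    using s live_path_act[of _ 0] by (fastforce simp: live_states_def)
  show "live_succ M s a \<in> live_states" if "a \<in> live_actions s" for a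
    using that by (simp add: live_actions_def)
qed

lemma live_path_live_play:
  assumes "strategy M \<sigma>" "pure M \<sigma>" "s \<in> states M - {avoid M}"
    and "\<And>i. 0 < case_prod (survival M) (live_play M s \<sigma> i)"
  shows "live_path (live_play M s \<sigma>)"
  unfolding live_path_def
proof (intro allI conjI)
  fix t
  have h: "history M (live_hist M s \<sigma> t)" "snd (live_hist M s \<sigma> t) \<in> states M - {avoid M}"
    using live_hist_history[OF assms(1-3)] assms(4) by auto
  show "fst (live_play M s \<sigma> t) \<in> states M - {avoid M}" using h by (simp add: live_play_def)
  show "snd (live_play M s \<sigma> t) \<in> actions M (fst (live_play M s \<sigma> t))"
    using chosen_eq(2)[OF assms(1,2) h(1)] by (simp add: live_play_def)
  show "fst (live_play M s \<sigma> (Suc t)) = case_prod (live_succ M) (live_play M s \<sigma> t)"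
    by (rule fst_live_play_Suc)
qed (rule assms(4))

text \<open>Once a factor is 0, the survival product of \<open>\<sigma>'\<close> stays 0 and can
  never again exceed that of \<open>\<sigma>\<close>. So overtaking is possible only from initial
  states in \<open>live_states\<close>.\<close>

lemma overtaking_live:
  assumes \<sigma>: "strategy M \<sigma>" "pure M \<sigma>" and \<sigma>': "strategy M \<sigma>'" "pure M \<sigma>'"
    and s: "s \<in> states M - {avoid M}" and over: "weakly_overtakes M s \<sigma>' \<sigma>"
  shows "live_path (live_play M s \<sigma>')"
proof (rule live_path_live_play[OF \<sigma>' s])
  fix i
  show "0 < case_prod (survival M) (live_play M s \<sigma>' i)"
  proof (rule ccontr)
    assume "\<not> ?thesis"
    then have zero: "case_prod (survival M) (live_play M s \<sigma>' i) = 0"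
      by (simp add: case_prod_beta not_less antisym survival_nonneg)
    obtain n where n: "n > i" "(\<Prod>i<n. case_prod (survival M) (live_play M s \<sigma> i)) <
        (\<Prod>i<n. case_prod (survival M) (live_play M s \<sigma>' i))"
      using weakly_overtakes_survival(2)[OF \<sigma> \<sigma>' s over] unfolding infinite_nat_iff_unbounded by blast
    moreover have "(\<Prod>i<n. case_prod (survival M) (live_play M s \<sigma>' i)) = 0"
      using n(1) zero by (intro prod_zero) auto
    moreover have "0 \<le> (\<Prod>i<n. case_prod (survival M) (live_play M s \<sigma> i))"
      by (intro prod_nonneg) (simp add: survival_nonneg case_prod_beta)
    ultimately show False by simp
  qed
qed

lemma ex_stationary_not_overtaken:
  "\<exists>\<sigma>. strategy M \<sigma> \<and> pure M \<sigma> \<and> stationary M \<sigma> \<and>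
     (\<forall>s\<in>states M - {avoid M}. \<forall>\<sigma>'. strategy M \<sigma>' \<and> pure M \<sigma>' \<longrightarrow> \<not> weakly_overtakes M s \<sigma>' \<sigma>)"
proof -
  interpret cost_graph live_states live_actions "live_succ M" "\<lambda>s a. - ln (survival M s a)"
    by (rule cost_graph_live)
  obtain f where f: "f \<in> Pi live_states live_actions"
    and opt: "\<forall>s q T. walk s q \<longrightarrow> (\<forall>t\<ge>T. cost q t \<le> cost (orbit f s) t) \<longrightarrow>
       finite {t. cost q t < cost (orbit f s) t}"
    using ex_not_overtaken by (rule bexE)
  \<comment> \<open>Any action will do outside \<open>live_states\<close>: no overtaking starts
    there, and orbits of \<open>f\<close> from live states never get there.\<close>
  define g where "g s = (if s \<in> live_states then f s else (SOME a. a \<in> actions M s))" for s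
  have g: "g s \<in> actions M s" if "s \<in> states M" for s
  proof (cases "s \<in> live_states")
    case True
    then show ?thesis using f by (auto simp: g_def live_actions_def)
  next
    case False
    then show ?thesis using mdp that by (simp add: g_def is_safety_mdp_def some_in_eq)
  qed
  define \<sigma> where "\<sigma> h = return_pmf (g (snd h))" for h :: "('s, 'a) hist"
  have "strategy M \<sigma>"
    using g by (auto simp: strategy_def \<sigma>_def history_def)
  moreover have "pure M \<sigma>"
    unfolding pure_def \<sigma>_def pmf_eq_1_iff by blast
  moreover have "stationary M \<sigma>"
    by (simp add: stationary_def \<sigma>_def)
  ultimately have \<sigma>: "strategy M \<sigma>" "pure M \<sigma>" "stationary M \<sigma>" by simp_all
  have chosen: "chosen \<sigma> h = g (snd h)" for h
    unfolding chosen_def \<sigma>_def pmf_eq_1_iff by simp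
  \<comment> \<open>Positive survival on a live path lets \<open>exp\<close> undo \<open>ln\<close>;
    larger survival products then correspond to smaller costs.\<close>
  have prod_eq: "(\<Prod>i<n. case_prod (survival M) (q i)) = exp (- cost q n)" if "live_path q" for q n
    using that by (simp add: cost_def live_path_def sum_negf exp_sum case_prod_beta)
  have "\<not> weakly_overtakes M s \<sigma>' \<sigma>"
    if s: "s \<in> states M - {avoid M}" and \<sigma>': "strategy M \<sigma>'" "pure M \<sigma>'" for s \<sigma>'
  proof
    assume over: "weakly_overtakes M s \<sigma>' \<sigma>"
    let ?q = "live_play M s \<sigma>'"
    have q: "live_path ?q" by (rule overtaking_live[OF \<sigma>(1,2) \<sigma>' s over])
    have q0: "fst (?q 0) = s" by (simp add: live_play_def)
    with live_path_in[OF q, of 0] have s_live: "s \<in> live_states" by simp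
    have walk_q: "walk s ?q"
      using s_live q0 live_path_act[OF q] q by (auto simp: walk_def live_path_def case_prod_beta)
    have w: "walk s (orbit f s)" by (rule walk_orbit[OF f s_live])
    \<comment> \<open>The orbit stays in \<open>live_states\<close>, where \<open>g\<close> agrees
      with \<open>f\<close>.\<close>
    have orb: "live_play M s \<sigma> n = orbit f s n" for n
    proof -
      have "snd (live_hist M s \<sigma> n) = fst (orbit f s n)"
      proof (induction n)
        case 0
        then show ?case by (simp add: orbit_def)
      next
        case (Suc n)
        with walk_in[OF w, of n] show ?case
          by (simp add: Let_def chosen g_def) (simp add: orbit_def Let_def)
      qed
      with walk_in[OF w, of n] show ?thesis
        by (simp add: live_play_def chosen g_def) (simp add: orbit_def Let_def)
    qed
    have orb_live: "live_path (orbit f s)"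
      unfolding live_path_def
    proof (intro allI conjI)
      fix t
      show "fst (orbit f s t) \<in> states M - {avoid M}"
        using walk_in[OF w] live_states_sub by blast
      show "snd (orbit f s t) \<in> actions M (fst (orbit f s t))"
        "0 < case_prod (survival M) (orbit f s t)"
        using walk_act[OF w, of t] by (auto simp: live_actions_def case_prod_beta)
      show "fst (orbit f s (Suc t)) = case_prod (live_succ M) (orbit f s t)"
        using w by (simp add: walk_def case_prod_beta)
    qed
    have orb_fun: "live_play M s \<sigma> = orbit f s" using orb by blast
    note * = weakly_overtakes_survival[OF \<sigma>(1,2) \<sigma>' s over,
        unfolded orb_fun prod_eq[OF q] prod_eq[OF orb_live] exp_le_cancel_iff exp_less_cancel_iff
          neg_le_iff_le neg_less_iff_less]
    from *(1) obtain T where "\<forall>t\<ge>T. cost ?q t \<le> cost (orbit f s) t" by blast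
    from opt[rule_format, OF walk_q, OF this[rule_format]] *(2) show False by blast
  qed
  with \<sigma> show ?thesis by blast
qed

end

theorem mainTheorem5:
  fixes M :: "('s, 'a) safety_mdp"
  assumes "is_safety_mdp M"
    and "deterministic M"
  shows "\<exists>\<sigma>. strategy M \<sigma> \<and> pure M \<sigma> \<and> stationary M \<sigma> \<and>
           (\<forall>s\<in>states M - {avoid M}. \<forall>\<sigma>'. strategy M \<sigma>' \<and> pure M \<sigma>' \<and> \<sigma>' \<noteq> \<sigma> \<longrightarrow>
              \<not> weakly_overtakes M s \<sigma>' \<sigma>)"
  using ex_stationary_not_overtaken[OF assms] by blast

end
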